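(* Let $n\ge 1$. There exist constants $c_n,\tau_n,\tau_n'>0$ depending only on the dimension $n$ such that if $w\in A_\infty$ is a weight on $\mathbb{R}^n$ with $[w]_{A_\infty}\le 1+c_n$, then $$w\in A_p\qquad\text{with}\qquad p=1+\tau_n([w]_{A_\infty}-1),$$ and moreover $$[w]_{A_p}\le \exp\big(\tau_n'([w]_{A_\infty}-1)\big).$$
   Context: Cubes $Q\subset\mathbb{R}^n$ have sides parallel to the coordinate axes. A weight is a locally integrable function $w$ on $\mathbb{R}^n$ with $0<w(x)<\infty$ for a.e. $x$; $w(Q)=\int_Q w\,dx$. For $1<p<\infty$, $w\in A_p$ means $[w]_{A_p}:=\sup_Q\left(\frac1{|Q|}\int_Q w\right)\left(\frac1{|Q|}\int_Q w^{1-p'}\right)^{p-1}<\infty$, where $p'=p/(p-1)$. For $p=1$, $w\in A_1$ means $[w]_{A_1}:=\sup_Q\left(\frac1{|Q|}\int_Q w\right)\operatorname{ess\,sup}_Q (w^{-1})<\infty$. The class $A_\infty:=\bigcup_{p\ge1}A_p$; equivalently $w\in A_\infty$ iff the Fujii--Wilson constant $[w]_{A_\infty}:=\sup_Q\frac1{w(Q)}\int_Q M(w\chi_Q)(x)\,dx$ is finite, where $Mf(x)=\sup_{Q\ni x}\frac1{|Q|}\int_Q|f|$ (supremum over cubes containing $x$) is the Hardy--Littlewood maximal function. One always has $[w]_{A_\infty}\ge1$. *)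

theory Defs
  imports "HOL-Analysis.Analysis" "HOL-Probability.Essential_Supremum"
begin

text \<open>Averages, maximal functions and weight constants are all taken in \<^typ>\<open>ennreal\<close>, so that
  divergent integrals and infinite suprema count as \<open>\<infinity>\<close>.\<close>

text \<open>Real powers on \<open>[0, \<infinity>]\<close>; meant only for exponents \<open>r > 0\<close>.\<close>

definition ennpowr :: "ennreal \<Rightarrow> real \<Rightarrow> ennreal" where
  "ennpowr t r = (if t = \<infinity> then \<infinity> else ennreal (enn2real t powr r))"

definition cubes :: "(real ^ 'n) set set" where
  "cubes = {cbox a (a + (\<chi> i. l)) | a l. 0 < l}"

definition avg :: "(real ^ 'n) set \<Rightarrow> (real ^ 'n \<Rightarrow> ennreal) \<Rightarrow> ennreal" where
  "avg Q f = (\<integral>\<^sup>+x\<in>Q. f x \<partial>lebesgue) / emeasure lebesgue Q"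

definition locally_integrable :: "(real ^ 'n \<Rightarrow> real) \<Rightarrow> bool" where
  "locally_integrable f \<longleftrightarrow> (\<forall>K. compact K \<longrightarrow> set_integrable lebesgue K f)"

text \<open>A weight is real valued, so finiteness is automatic. It may be \<open>\<le> 0\<close> on a null set, where
  \<^const>\<open>ennreal\<close> truncates; this affects none of the integrals or essential suprema below.\<close>

definition weight :: "(real ^ 'n \<Rightarrow> real) \<Rightarrow> bool" where
  "weight w \<longleftrightarrow> locally_integrable w \<and> (AE x in lebesgue. 0 < w x)"

definition conj_exponent :: "real \<Rightarrow> real" where
  "conj_exponent p = p / (p - 1)"

text \<open>The constant \<open>[w]\<close> for \<open>A\<^sub>p\<close>, meaningful for \<open>p \<ge> 1\<close>.\<close>

definition Ap_const :: "real \<Rightarrow> (real ^ 'n \<Rightarrow> real) \<Rightarrow> ennreal" where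
  "Ap_const p w =
    (if p = 1 then
       SUP Q\<in>cubes. avg Q (\<lambda>x. ennreal (w x)) *
         esssup (restrict_space lebesgue Q) (\<lambda>x. inverse (ennreal (w x)))
     else
       SUP Q\<in>cubes. avg Q (\<lambda>x. ennreal (w x)) *
         ennpowr (avg Q (\<lambda>x. ennreal (w x powr (1 - conj_exponent p)))) (p - 1))"

definition Ap :: "real \<Rightarrow> (real ^ 'n \<Rightarrow> real) set" where
  "Ap p = {w. weight w \<and> 1 \<le> p \<and> Ap_const p w < \<infinity>}"

definition Ainfty :: "(real ^ 'n \<Rightarrow> real) set" where
  "Ainfty = (\<Union>p\<in>{1..}. Ap p)"

text \<open>The (uncentred) Hardy--Littlewood maximal function over cubes.\<close>

definition maximal :: "(real ^ 'n \<Rightarrow> real) \<Rightarrow> real ^ 'n \<Rightarrow> ennreal" where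
  "maximal f x = (SUP Q\<in>{Q \<in> cubes. x \<in> Q}. avg Q (\<lambda>y. ennreal \<bar>f y\<bar>))"

text \<open>The Fujii--Wilson constant.\<close>

definition Ainfty_const :: "(real ^ 'n \<Rightarrow> real) \<Rightarrow> ennreal" where
  "Ainfty_const w =
    (SUP Q\<in>cubes. (\<integral>\<^sup>+x\<in>Q. maximal (\<lambda>y. w y * indicator Q y) x \<partial>lebesgue) /
                    (\<integral>\<^sup>+x\<in>Q. ennreal (w x) \<partial>lebesgue))"

end

(*
  Write [w] = 1 + \<delta>. On a cube Q, the maximal function of w \<chi>_Q is at least the average w_Q, and by
  Lebesgue differentiation at least w almost everywhere. Hence the average of max(w, w_Q) over Q is at
  most (1 + \<delta>) w_Q: w has mean oscillation O(\<delta>) w_Q on every cube Q. A John-Nirenberg stopping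
  time argument on dyadic subcubes then makes the average of (w_Q / w)^s bounded for s = 1 / (\<tau> \<delta>)
  with \<tau> dimensional. The power p - 1 = 1 / s of this bound is exp(O(\<delta>)). When \<delta> = 0 the weight is
  constant.

  Bounding the averages over the dyadic subcubes of depth k by induction on k, uniformly in k, needs
  only finite sums, and Fatou's lemma passes to the limit. The differentiation theorem in the
  library is for cubes with the point at a corner, and near-constancy of the averages of w transfers
  it to dyadic cubes.
*)

theory Submission
  imports Defs "HOL-Real_Asymp.Real_Asymp"
begin

subsection \<open>Half-open cubes and averages\<close>

text \<open>Half-open, so that the 2^n halves of a cell partition it exactly. The closed cubes of
  \<open>cubes\<close> differ from cells only by null sets.\<close>

definition cell :: "real ^ 'n \<Rightarrow> real \<Rightarrow> (real ^ 'n) set" where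
  "cell a l = {x. \<forall>i. a $ i \<le> x $ i \<and> x $ i < a $ i + l}"

text \<open>The halves of a cell are indexed by the set \<open>e\<close> of coordinates in which the
  upper half interval is taken.\<close>

definition corner :: "real ^ 'n \<Rightarrow> real \<Rightarrow> 'n set \<Rightarrow> real ^ 'n" where
  "corner a l e = (\<chi> i. if i \<in> e then a $ i + l / 2 else a $ i)"

definition mean :: "(real ^ 'n \<Rightarrow> real) \<Rightarrow> real ^ 'n \<Rightarrow> real \<Rightarrow> real" where
  "mean f a l = (LINT x:cell a l|lebesgue. f x) / l ^ CARD('n)"

lemma cell_borel [measurable]: "cell a l \<in> sets borel"
proof -
  have "cell a l = (\<Inter>i. {x. a $ i \<le> x $ i} \<inter> {x. x $ i < a $ i + l})"
    by (auto simp: cell_def)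
  also have "\<dots> \<in> sets borel"
    by (intro sets.finite_INT sets.Int borel_closed borel_open closed_Collect_le open_Collect_less
        continuous_intros) auto
  finally show ?thesis .
qed

lemma cell_lebesgue [measurable]: "cell a l \<in> sets lebesgue"
  using cell_borel by (metis sets_completionI_sets sets_lborel)

lemma box_subset_cell: "box a (a + (\<chi> i. l)) \<subseteq> cell a l"
  by (auto simp: cell_def mem_box_cart less_imp_le)

lemma cell_subset_cbox: "cell a l \<subseteq> cbox a (a + (\<chi> i. l))"
  by (auto simp: cell_def mem_box_cart less_imp_le)

lemma AE_cbox_box: "AE x in lebesgue. x \<in> cbox a b \<longrightarrow> x \<in> box a b"
proof -
  have "cbox a b - box a b \<in> null_sets lebesgue"
    using negligible_frontier_interval negligible_iff_null_sets by blast
  then show ?thesis by (rule AE_I') auto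
qed

lemma AE_cell_cbox: "AE x in lebesgue. x \<in> cell a l \<longleftrightarrow> x \<in> cbox a (a + (\<chi> i. l))"
  using AE_cbox_box[of a "a + (\<chi> i. l)"]
  by eventually_elim (use box_subset_cell cell_subset_cbox in blast)

lemma emeasure_cbox_side:
  fixes a :: "real ^ 'n"
  assumes "0 < l"
  shows "emeasure lebesgue (cbox a (a + (\<chi> i. l))) = ennreal (l ^ CARD('n))"
proof -
  have "cbox a (a + (\<chi> i. l)) \<noteq> {}"
    using assms by (auto simp: interval_ne_empty_cart less_imp_le)
  then have "measure lebesgue (cbox a (a + (\<chi> i. l))) = l ^ CARD('n)"
    by (simp add: content_cbox_cart)
  moreover have "cbox a (a + (\<chi> i. l)) \<in> lmeasurable" by simp
  ultimately show ?thesis by (metis emeasure_eq_measure2 fmeasurableD2 emeasure_eq_ennreal_measure)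
qed

lemma emeasure_cell:
  fixes a :: "real ^ 'n"
  assumes "0 < l"
  shows "emeasure lebesgue (cell a l) = ennreal (l ^ CARD('n))"
  using emeasure_cbox_side[OF assms, of a] AE_cell_cbox[of a l]
  by (metis emeasure_eq_AE cell_lebesgue lborelD sets_completionI_sets borel_closed closed_cbox sets_lborel)

lemma measure_cell:
  fixes a :: "real ^ 'n"
  assumes "0 < l"
  shows "measure lebesgue (cell a l) = l ^ CARD('n)"
  using emeasure_cell[OF assms, of a] assms by (simp add: measure_def)

text \<open>The index \<open>e\<close> of the half containing \<open>x\<close> can be read off from
  \<open>x\<close>; covering and disjointness of the halves both follow from this.\<close>

lemma cell_corner_iff:
  assumes "0 < l"
  shows "x \<in> cell (corner a l e) (l / 2) \<longleftrightarrow> x \<in> cell a l \<and> e = {i. a $ i + l / 2 \<le> x $ i}"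
proof
  assume *: "x \<in> cell (corner a l e) (l / 2)"
  have "a $ i \<le> x $ i \<and> x $ i < a $ i + l \<and> (i \<in> e \<longleftrightarrow> a $ i + l / 2 \<le> x $ i)" for i
    using *[unfolded cell_def corner_def, simplified, rule_format, of i] assms
    by (auto split: if_splits)
  then show "x \<in> cell a l \<and> e = {i. a $ i + l / 2 \<le> x $ i}"
    by (auto simp: cell_def)
next
  assume *: "x \<in> cell a l \<and> e = {i. a $ i + l / 2 \<le> x $ i}"
  then show "x \<in> cell (corner a l e) (l / 2)"
    using assms by (simp add: cell_def corner_def) (smt (verit))
qed

lemma cell_corner_subset: "0 < l \<Longrightarrow> cell (corner a l e) (l / 2) \<subseteq> cell a l"
  by (auto simp: cell_corner_iff)

lemma cell_eq_UN: "0 < l \<Longrightarrow> cell a l = (\<Union>e. cell (corner a l e) (l / 2))"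
  by (auto simp: cell_corner_iff)

lemma disjoint_corners: "0 < l \<Longrightarrow> disjoint_family (\<lambda>e. cell (corner a l e) (l / 2))"
  by (auto simp: disjoint_family_on_def cell_corner_iff)

lemma card_set_UNIV: "card (UNIV :: 'n::finite set set) = 2 ^ CARD('n)"
  by (metis Pow_UNIV card_Pow finite_class.finite_UNIV)

lemma mean_split:
  fixes f :: "real ^ 'n \<Rightarrow> real"
  assumes "0 < l" and f: "set_integrable lebesgue (cell a l) f"
  shows "mean f a l = (\<Sum>e\<in>UNIV. mean f (corner a l e) (l / 2)) / 2 ^ CARD('n)"
proof -
  have "(LINT x:cell a l|lebesgue. f x) = (\<Sum>e\<in>UNIV. LINT x:cell (corner a l e) (l / 2)|lebesgue. f x)"
    unfolding cell_eq_UN[OF assms(1)]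
  proof (rule set_integral_finite_Union)
    show "disjoint_family_on (\<lambda>e. cell (corner a l e) (l / 2)) UNIV"
      using disjoint_corners[OF assms(1)] .
    show "set_integrable lebesgue (cell (corner a l e) (l / 2)) f" for e
      by (rule set_integrable_subset[OF f]) (use cell_corner_subset[OF assms(1)] in auto)
  qed auto
  then show ?thesis using assms(1)
    by (simp add: mean_def sum_divide_distrib power_divide field_simps)
qed

lemma mean_mono:
  fixes f :: "real ^ 'n \<Rightarrow> real"
  assumes "0 < l" "set_integrable lebesgue (cell a l) f" "set_integrable lebesgue (cell a l) g"
    and "\<And>x. x \<in> cell a l \<Longrightarrow> f x \<le> g x"
  shows "mean f a l \<le> mean g a l"
  unfolding mean_def using assms by (intro divide_right_mono set_integral_mono) auto

lemma set_integrable_cell_const: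
  fixes a :: "real ^ 'n"
  assumes "0 < l"
  shows "set_integrable lebesgue (cell a l) (\<lambda>x. c :: real)"
  unfolding set_integrable_def
  by (rule integrable_scaleR_left) (simp add: emeasure_cell[OF assms])

lemma mean_const:
  fixes a :: "real ^ 'n"
  assumes "0 < l"
  shows "mean (\<lambda>x. c) a l = c"
  using assms measure_cell[OF assms, of a]
  by (simp add: mean_def set_lebesgue_integral_def)

lemma mean_diff:
  fixes f :: "real ^ 'n \<Rightarrow> real"
  assumes "set_integrable lebesgue (cell a l) f" "set_integrable lebesgue (cell a l) g"
  shows "mean (\<lambda>x. f x - g x) a l = mean f a l - mean g a l"
  using set_integral_diff(2)[OF assms] by (simp add: mean_def diff_divide_distrib)

lemma mean_nonneg:
  fixes f :: "real ^ 'n \<Rightarrow> real"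
  assumes "0 < l" "\<And>x. 0 \<le> f x"
  shows "0 \<le> mean f a l"
  using assms by (auto simp: mean_def set_lebesgue_integral_def intro!: divide_nonneg_nonneg integral_nonneg_AE)

text \<open>Monotonicity of the integral, with the measures in ratio 2^n. The subcell may sit
  anywhere in the larger cell, not only at a dyadic position.\<close>

lemma mean_subcell_le:
  fixes f :: "real ^ 'n \<Rightarrow> real"
  assumes "0 < h" and sub: "cell b h \<subseteq> cell a (2 * h)"
    and f: "set_integrable lebesgue (cell a (2 * h)) f" and nonneg: "\<And>x. 0 \<le> f x"
  shows "mean f b h \<le> 2 ^ CARD('n) * mean f a (2 * h)"
proof -
  have "set_integrable lebesgue (cell b h) f"
    by (rule set_integrable_subset[OF f]) (use sub in auto)
  then have "(LINT x:cell b h|lebesgue. f x) \<le> (LINT x:cell a (2 * h)|lebesgue. f x)"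
    using f nonneg sub unfolding set_lebesgue_integral_def set_integrable_def
    by (intro integral_mono) (auto simp: indicator_def)
  then show ?thesis
    using \<open>0 < h\<close> by (simp add: mean_def field_simps)
qed

lemma set_integrable_max0:
  fixes f :: "'a \<Rightarrow> real"
  assumes "set_integrable M A f"
  shows "set_integrable M A (\<lambda>x. max 0 (f x))"
proof -
  have "integrable M (\<lambda>x. max 0 (indicat_real A x *\<^sub>R f x))"
    using assms unfolding set_integrable_def by (intro integrable_max) auto
  also have "(\<lambda>x. max 0 (indicat_real A x *\<^sub>R f x)) = (\<lambda>x. indicat_real A x *\<^sub>R max 0 (f x))"
    by (auto simp: indicator_def)
  finally show ?thesis unfolding set_integrable_def .
qed

subsection \<open>Dyadic averages\<close>

text \<open>Here \<open>g\<close> is any function of cells, later a negative power of the mean of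
  \<open>w\<close>; it is averaged over the 2^(nk) dyadic subcells of depth
  \<open>k\<close>.\<close>

primrec dyadic_mean :: "nat \<Rightarrow> (real ^ 'n \<Rightarrow> real \<Rightarrow> real) \<Rightarrow> real ^ 'n \<Rightarrow> real \<Rightarrow> real" where
  "dyadic_mean 0 g a l = g a l"
| "dyadic_mean (Suc k) g a l =
    (\<Sum>e\<in>UNIV. dyadic_mean k g (corner a l e) (l / 2)) / 2 ^ CARD('n)"

text \<open>The step function that on each dyadic subcell of depth \<open>k\<close> takes the value
  of \<open>g\<close> at that subcell. It is \<open>ennreal\<close> valued because Fatou's lemma is
  applied to it.\<close>

primrec dyadic_fun ::
  "nat \<Rightarrow> (real ^ 'n \<Rightarrow> real \<Rightarrow> real) \<Rightarrow> real ^ 'n \<Rightarrow> real \<Rightarrow> real ^ 'n \<Rightarrow> ennreal" where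
  "dyadic_fun 0 g a l x = ennreal (g a l) * indicator (cell a l) x"
| "dyadic_fun (Suc k) g a l x = (\<Sum>e\<in>UNIV. dyadic_fun k g (corner a l e) (l / 2) x)"

lemma dyadic_fun_measurable [measurable]: "dyadic_fun k g a l \<in> borel_measurable lebesgue"
proof (induction k arbitrary: a l)
  case 0
  have "dyadic_fun 0 g a l = (\<lambda>x. ennreal (g a l) * indicator (cell a l) x)" by auto
  also have "\<dots> \<in> borel_measurable lebesgue" by measurable
  finally show ?case .
next
  case (Suc k)
  have "dyadic_fun (Suc k) g a l = (\<lambda>x. \<Sum>e\<in>UNIV. dyadic_fun k g (corner a l e) (l / 2) x)" by auto
  also have "\<dots> \<in> borel_measurable lebesgue" using Suc by measurable
  finally show ?case .
qed

lemma dyadic_mean_nonneg: "(\<And>a l. 0 \<le> g a l) \<Longrightarrow> 0 \<le> dyadic_mean k g a l"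
  by (induction k arbitrary: a l) (auto intro!: sum_nonneg divide_nonneg_nonneg)

lemma nn_integral_dyadic_fun:
  fixes a :: "real ^ 'n"
  assumes "0 < l" and g: "\<And>a l. 0 \<le> g a l"
  shows "(\<integral>\<^sup>+x. dyadic_fun k g a l x \<partial>lebesgue) = ennreal (l ^ CARD('n) * dyadic_mean k g a l)"
  using assms(1)
proof (induction k arbitrary: a l)
  case 0
  then show ?case
    using g[of a l] emeasure_cell[OF 0, of a]
    by (simp add: nn_integral_cmult_indicator ennreal_mult' mult.commute)
next
  case (Suc k)
  have "(\<integral>\<^sup>+x. dyadic_fun (Suc k) g a l x \<partial>lebesgue)
      = (\<Sum>e\<in>UNIV. \<integral>\<^sup>+x. dyadic_fun k g (corner a l e) (l / 2) x \<partial>lebesgue)"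
    by (simp add: nn_integral_sum)
  also have "\<dots> = (\<Sum>e\<in>UNIV. ennreal ((l / 2) ^ CARD('n) * dyadic_mean k g (corner a l e) (l / 2)))"
    using Suc by simp
  also have "\<dots> = ennreal (\<Sum>e\<in>UNIV. (l / 2) ^ CARD('n) * dyadic_mean k g (corner a l e) (l / 2))"
    using Suc.prems g by (intro sum_ennreal) (auto simp: dyadic_mean_nonneg)
  also have "(\<Sum>e\<in>UNIV. (l / 2) ^ CARD('n) * dyadic_mean k g (corner a l e) (l / 2))
      = l ^ CARD('n) * dyadic_mean (Suc k) g a l"
    by (simp add: sum_distrib_left sum_divide_distrib power_divide)
  finally show ?case .
qed

lemma dyadic_fun_outside: "0 < l \<Longrightarrow> x \<notin> cell a l \<Longrightarrow> dyadic_fun k g a l x = 0"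
proof (induction k arbitrary: a l)
  case (Suc k)
  then show ?case using cell_corner_subset[of l a] by (auto intro!: Suc.IH)
qed auto

lemma dyadic_fun_eq:
  assumes "0 < l" "x \<in> cell a l"
  obtains b where "x \<in> cell b (l / 2 ^ k)" "dyadic_fun k g a l x = ennreal (g b (l / 2 ^ k))"
proof -
  have "\<exists>b. x \<in> cell b (l / 2 ^ k) \<and> dyadic_fun k g a l x = ennreal (g b (l / 2 ^ k))"
    using assms
  proof (induction k arbitrary: a l)
    case 0
    then show ?case by auto
  next
    case (Suc k)
    \<comment> \<open>The half containing \<open>x\<close>; the other summands vanish by
      \<open>dyadic_fun_outside\<close>.\<close>
    define e where "e = {i. a $ i + l / 2 \<le> x $ i}"
    have x: "x \<in> cell (corner a l e') (l / 2) \<longleftrightarrow> e' = e" for e'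
      using cell_corner_iff[OF Suc.prems(1)] Suc.prems(2) by (auto simp: e_def)
    have "dyadic_fun (Suc k) g a l x
        = (\<Sum>e'\<in>UNIV. if e' = e then dyadic_fun k g (corner a l e') (l / 2) x else 0)"
      unfolding dyadic_fun.simps
      by (intro sum.cong) (use Suc.prems x in \<open>auto intro!: dyadic_fun_outside\<close>)
    also have "\<dots> = dyadic_fun k g (corner a l e) (l / 2) x" by simp
    finally have *: "dyadic_fun (Suc k) g a l x = dyadic_fun k g (corner a l e) (l / 2) x" .
    have "\<exists>b. x \<in> cell b (l / 2 / 2 ^ k) \<and>
        dyadic_fun k g (corner a l e) (l / 2) x = ennreal (g b (l / 2 / 2 ^ k))"
      using Suc.prems x[of e] by (intro Suc.IH) auto
    then show ?case by (auto simp: *[unfolded dyadic_fun.simps])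
  qed
  then show ?thesis using that by blast
qed

subsection \<open>Weights\<close>

locale weight_function =
  fixes w :: "real ^ 'n \<Rightarrow> real"
  assumes weight: "weight w"
begin

lemma AE_pos: "AE x in lebesgue. 0 < w x"
  using weight by (simp add: weight_def)

lemma integrable_cbox: "set_integrable lebesgue (cbox a b) w"
  using weight by (simp add: weight_def locally_integrable_def)

lemma integrable_cell: "set_integrable lebesgue (cell a l) w"
  by (rule set_integrable_subset[OF integrable_cbox]) (auto intro: cell_subset_cbox[THEN subsetD])

lemma mean_pos:
  assumes "0 < l"
  shows "0 < mean w a l"
proof -
  let ?f = "\<lambda>x. indicat_real (cell a l) x *\<^sub>R w x"
  have f: "integrable lebesgue ?f" using integrable_cell by (simp add: set_integrable_def)
  have nonneg: "AE x in lebesgue. 0 \<le> ?f x"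
    using AE_pos by eventually_elim (auto simp: indicator_def)
  have "integral\<^sup>L lebesgue ?f \<noteq> 0"
  proof
    assume "integral\<^sup>L lebesgue ?f = 0"
    then have "AE x in lebesgue. ?f x = 0"
      using integral_nonneg_eq_0_iff_AE[OF f nonneg] by simp
    with AE_pos have "AE x in lebesgue. x \<notin> cell a l"
      by eventually_elim (auto simp: indicator_def split: if_splits)
    then have "emeasure lebesgue (cell a l) = 0"
      using AE_iff_measurable[of "cell a l" lebesgue "\<lambda>x. x \<notin> cell a l"] by auto
    then show False using emeasure_cell[OF assms, of a] assms by simp
  qed
  moreover have "0 \<le> integral\<^sup>L lebesgue ?f" using nonneg by (rule integral_nonneg_AE)
  ultimately show ?thesis using assms by (simp add: mean_def set_lebesgue_integral_def)
qed

text \<open>Lebesgue differentiation along the cubes with lower corner \<open>x\<close>; the change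
  from closed cubes to cells costs nothing, their difference being null.\<close>

lemma AE_mean_tendsto: "AE x in lebesgue. (mean w x \<longlongrightarrow> w x) (at_right 0)"
proof -
  have One: "h *\<^sub>R One = ((\<chi> i. h) :: real ^ 'n)" for h :: real
    by (simp add: const_vector_cart scaleR_right.sum)
  have mean_eq: "mean w x h = integral (cbox x (x + h *\<^sub>R One)) w /\<^sub>R h ^ DIM(real ^ 'n)" for x h
  proof -
    have "(LINT y:cell x h|lebesgue. w y) = (LINT y:cbox x (x + (\<chi> i. h))|lebesgue. w y)"
      using AE_cell_cbox[of x h] integrable_cbox integrable_cell
      unfolding set_lebesgue_integral_def set_integrable_def
      by (intro integral_cong_AE borel_measurable_integrable) (auto simp: indicator_def)
    then show ?thesis
      using set_lebesgue_integral_eq_integral(2)[OF integrable_cbox]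
      by (simp add: mean_def One divide_inverse_commute)
  qed
  have "w integrable_on cbox a b" for a b
    using set_lebesgue_integral_eq_integral(1)[OF integrable_cbox] .
  then obtain N where N: "negligible N"
    "\<And>x e. x \<notin> N \<Longrightarrow> 0 < e \<Longrightarrow> \<exists>d>0. \<forall>h. 0 < h \<and> h < d \<longrightarrow> norm (mean w x h - w x) < e"
    using integrable_ccontinuous_explicit[of w] unfolding mean_eq by metis
  have "(mean w x \<longlongrightarrow> w x) (at_right 0)" if "x \<notin> N" for x
    using N(2)[OF that] by (force intro!: tendstoI simp: dist_norm eventually_at_right_field)
  with N(1) show ?thesis
    by (intro AE_I'[of N]) (auto simp: negligible_iff_null_sets)
qed

lemma w_measurable [measurable]: "w \<in> borel_measurable lebesgue"
proof -
  have "w integrable_on cbox a b" for a b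
    using set_lebesgue_integral_eq_integral(1)[OF integrable_cbox] .
  then have "w measurable_on UNIV" by (rule integrable_subintervals_imp_measurable)
  then show ?thesis by (simp add: measurable_on_iff_borel_measurable)
qed

lemma integrable_below: "0 < l \<Longrightarrow> set_integrable lebesgue (cell a l) (\<lambda>x. max 0 (c - w x))"
  by (intro set_integrable_max0 set_integral_diff set_integrable_cell_const integrable_cell)

lemma integrable_above: "0 < l \<Longrightarrow> set_integrable lebesgue (cell a l) (\<lambda>x. max 0 (w x - c))"
  by (intro set_integrable_max0 set_integral_diff set_integrable_cell_const integrable_cell)

lemma mean_below_ge: "0 < l \<Longrightarrow> c - mean w a l \<le> mean (\<lambda>x. max 0 (c - w x)) a l"
proof -
  assume l: "0 < l"
  have "c - mean w a l = mean (\<lambda>x. c - w x) a l"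
    using l by (subst mean_diff) (auto simp: mean_const set_integrable_cell_const integrable_cell)
  also have "\<dots> \<le> mean (\<lambda>x. max 0 (c - w x)) a l"
    using l by (intro mean_mono integrable_below set_integral_diff set_integrable_cell_const integrable_cell) auto
  finally show ?thesis .
qed

text \<open>Integrate \<open>w - c\<close> as positive part minus negative part. When
  \<open>c\<close> is the mean of \<open>w\<close>, the excess and the deficit have the same
  mean.\<close>

lemma mean_above_eq:
  "0 < l \<Longrightarrow> mean (\<lambda>x. max 0 (w x - c)) a l = mean (\<lambda>x. max 0 (c - w x)) a l + (mean w a l - c)"
proof -
  assume l: "0 < l"
  have "mean w a l - c = mean (\<lambda>x. w x - c) a l"
    using l by (subst mean_diff) (auto simp: mean_const set_integrable_cell_const integrable_cell)
  also have "(\<lambda>x. w x - c) = (\<lambda>x. max 0 (w x - c) - max 0 (c - w x))" by auto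
  also have "mean \<dots> a l = mean (\<lambda>x. max 0 (w x - c)) a l - mean (\<lambda>x. max 0 (c - w x)) a l"
    using l by (intro mean_diff integrable_below integrable_above)
  finally show ?thesis by simp
qed

end

subsection \<open>The stopping time argument\<close>

text \<open>Flatness is stated for the deficit below the mean, the quantity charged to stopped
  cubes. By \<open>mean_above_eq\<close> it bounds the excess equally, so the mean oscillation is at
  most 2 \<delta> times the mean.\<close>

locale flat_weight = weight_function w for w :: "real ^ 'n \<Rightarrow> real" +
  fixes \<delta> :: real
  assumes flat: "0 < l \<Longrightarrow> mean (\<lambda>x. max 0 (mean w a l - w x)) a l \<le> \<delta> * mean w a l"
begin

text \<open>Passing to a subcell of half the side inflates the mean deficit by at most 2^n, and the
  mean deficit bounds how far the mean drops. \<open>subcell_le\<close> is the same argument with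
  the excess.\<close>

lemma subcell_ge:
  assumes "0 < h" "cell b h \<subseteq> cell a (2 * h)"
  shows "(1 - 2 ^ CARD('n) * \<delta>) * mean w a (2 * h) \<le> mean w b h"
proof -
  define M where "M = mean w a (2 * h)"
  have "M - mean w b h \<le> mean (\<lambda>x. max 0 (M - w x)) b h"
    using assms(1) by (rule mean_below_ge)
  also have "\<dots> \<le> 2 ^ CARD('n) * mean (\<lambda>x. max 0 (M - w x)) a (2 * h)"
    using assms by (intro mean_subcell_le integrable_below) auto
  also have "\<dots> \<le> 2 ^ CARD('n) * (\<delta> * M)"
    unfolding M_def using assms(1) by (intro mult_left_mono flat) auto
  finally show ?thesis by (simp add: M_def algebra_simps)
qed

lemma subcell_le:
  assumes "0 < h" "cell b h \<subseteq> cell a (2 * h)"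
  shows "mean w b h \<le> (1 + 2 ^ CARD('n) * \<delta>) * mean w a (2 * h)"
proof -
  define M where "M = mean w a (2 * h)"
  have "mean w b h - M \<le> mean (\<lambda>x. max 0 (w x - M)) b h"
    using mean_above_eq[OF assms(1), of M b] mean_nonneg[OF assms(1), of "\<lambda>x. max 0 (M - w x)" b] by simp
  also have "\<dots> \<le> 2 ^ CARD('n) * mean (\<lambda>x. max 0 (w x - M)) a (2 * h)"
    using assms by (intro mean_subcell_le integrable_above) auto
  also have "\<dots> \<le> 2 ^ CARD('n) * (\<delta> * M)"
    using assms(1) flat[of "2 * h" a] mean_above_eq[of "2 * h" M a] unfolding M_def
    by (intro mult_left_mono) auto
  finally show ?thesis by (simp add: M_def algebra_simps)
qed

text \<open>Subdivision stops at the cubes where the mean drops below the threshold \<open>t\<close>. The last summand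
  absorbs them: a stopped cube contributes at least \<open>c - t\<close> times its measure to the integral of
  \<open>max 0 (c - w)\<close>, and its mean is only slightly below \<open>t\<close>.\<close>

lemma dyadic_mean_stopping:
  assumes "0 < s" "0 < t" "t < c" and small: "2 ^ CARD('n) * \<delta> < 1" and "0 \<le> C" "0 < l"
    and C: "\<And>j a l. j < k \<Longrightarrow> 0 < l \<Longrightarrow>
        dyadic_mean j (\<lambda>a l. mean w a l powr - s) a l \<le> C * mean w a l powr - s"
    and "t \<le> mean w a l"
  shows "dyadic_mean k (\<lambda>a l. mean w a l powr - s) a l \<le> t powr - s +
    C * ((1 - 2 ^ CARD('n) * \<delta>) * t) powr - s / (c - t) * mean (\<lambda>x. max 0 (c - w x)) a l"
    (is "_ \<le> _ + ?B * _")
  using assms(6-)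
proof (induction k arbitrary: a l)
  case 0
  have "0 \<le> ?B * mean (\<lambda>x. max 0 (c - w x)) a l"
    using assms 0 by (intro mult_nonneg_nonneg divide_nonneg_nonneg mean_nonneg) auto
  moreover have "mean w a l powr - s \<le> t powr - s"
    using assms 0 by (intro powr_mono2') auto
  ultimately show ?case by simp
next
  case (Suc k)
  let ?g = "\<lambda>a l. mean w a l powr - s"
  have B: "0 \<le> ?B" using assms by auto
  have "dyadic_mean k ?g (corner a l e) (l / 2)
      \<le> t powr - s + ?B * mean (\<lambda>x. max 0 (c - w x)) (corner a l e) (l / 2)" for e
  proof (cases "t \<le> mean w (corner a l e) (l / 2)")
    case True
    then show ?thesis using Suc by (intro Suc.IH) auto
  next
    case False
    let ?m = "mean w (corner a l e) (l / 2)"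
    \<comment> \<open>The parent is not stopped, so its mean is at least \<open>t\<close>, and one
      halving cannot bring the mean far below \<open>t\<close>.\<close>
    have "(1 - 2 ^ CARD('n) * \<delta>) * t \<le> (1 - 2 ^ CARD('n) * \<delta>) * mean w a l"
      using small Suc.prems by (intro mult_left_mono) auto
    also have "\<dots> \<le> ?m"
      using subcell_ge[of "l / 2" "corner a l e" a] cell_corner_subset[of l a e] Suc.prems by simp
    finally have jump: "(1 - 2 ^ CARD('n) * \<delta>) * t \<le> ?m" .
    \<comment> \<open>The stopped cell is handed to the assumed bound at the remaining depth
      \<open>k\<close>, which is less than \<open>Suc k\<close>.\<close>
    have "dyadic_mean k ?g (corner a l e) (l / 2) \<le> C * ?m powr - s"
      using Suc.prems by (intro Suc.prems(2)) auto
    also have "\<dots> \<le> C * ((1 - 2 ^ CARD('n) * \<delta>) * t) powr - s"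
      using assms jump by (intro mult_left_mono powr_mono2') auto
    also have "\<dots> = ?B * (c - t)" using assms by simp
    \<comment> \<open>A mean below \<open>t\<close> forces a mean deficit of at least
      \<open>c - t\<close>.\<close>
    also have "\<dots> \<le> ?B * mean (\<lambda>x. max 0 (c - w x)) (corner a l e) (l / 2)"
      using mean_below_ge[of "l / 2" c "corner a l e"] False Suc.prems by (intro mult_left_mono[OF _ B]) auto
    finally show ?thesis by (simp add: add_increasing)
  qed
  then have "dyadic_mean (Suc k) ?g a l \<le> (\<Sum>e\<in>UNIV. t powr - s +
      ?B * mean (\<lambda>x. max 0 (c - w x)) (corner a l e) (l / 2)) / 2 ^ CARD('n)"
    by (auto intro!: divide_right_mono sum_mono)
  \<comment> \<open>The deficits of the halves average to the deficit of the whole cell, so the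
    bound reproduces itself.\<close>
  also have "\<dots> = t powr - s + ?B * mean (\<lambda>x. max 0 (c - w x)) a l"
    using Suc.prems
    by (subst mean_split[of l a, OF _ integrable_below])
      (auto simp: sum.distrib card_set_UNIV add_divide_distrib sum_distrib_left
        sum_divide_distrib[symmetric])
  finally show ?case .
qed

end

section \<open>The choice of the exponent and the bound uniform in the depth\<close>

lemma one_minus_powr_le:
  fixes x s :: real
  assumes "0 \<le> x" "x \<le> 1 / 2" "0 \<le> s"
  shows "(1 - x) powr - s \<le> exp (2 * x * s)"
proof -
  have "- x - 2 * x\<^sup>2 \<le> ln (1 - x)"
    using assms by (intro ln_one_minus_pos_lower_bound)
  moreover have "2 * x\<^sup>2 \<le> x"
    using assms mult_left_mono[of "x" "1/2" x] by (simp add: power2_eq_square)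
  ultimately have "- ln (1 - x) \<le> 2 * x" by simp
  then have "- s * ln (1 - x) \<le> 2 * x * s"
    using mult_right_mono[of "- ln (1 - x)" "2 * x" s] assms by (simp add: mult.commute)
  then show ?thesis using assms by (simp add: powr_def)
qed

text \<open>The smallness condition makes 4 \<delta> and 2^n \<delta> at most 1/2. The exponent
  \<open>s\<close> is of order 1/\<delta>, so that \<open>s\<close>-th powers of ratios 1 +
  O(\<delta>) stay bounded; its constant is chosen for \<open>powr_bounds\<close>.\<close>

locale very_flat_weight = flat_weight w \<delta> for w :: "real ^ 'n \<Rightarrow> real" and \<delta> +
  fixes s :: real
  assumes \<delta>: "0 < \<delta>" "\<delta> * (8 + 2 * 2 ^ CARD('n)) \<le> 1"
    and s: "s * (\<delta> * (16 + 4 * 2 ^ CARD('n))) = 1"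
begin

lemma s_pos: "0 < s"
  using s \<delta> by (metis add_pos_pos mult_pos_pos not_less zero_less_mult_iff zero_less_numeral zero_less_one zero_less_power less_asym')

lemma \<delta>_bounds: "4 * \<delta> \<le> 1 / 2" "2 ^ CARD('n) * \<delta> \<le> 1 / 2"
  using \<delta> by (auto simp: algebra_simps intro: order_trans[rotated])

lemma exp_half_le: "exp (1 / 2) \<le> (2 :: real)"
proof -
  have "(exp (1 / 2 :: real))\<^sup>2 \<le> 2\<^sup>2"
    using exp_le by (simp add: power2_eq_square exp_add[symmetric])
  then show ?thesis by (rule power2_le_imp_le) simp
qed

text \<open>By \<open>one_minus_powr_le\<close> the two factors are at most the exponentials of 8
  \<delta> s and 2 * 2^n \<delta> s, and \<open>s\<close> is chosen so that these sum to 1/2. The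
  numbers 2 and 3 then bound exp (1/2) and exp 1.\<close>

lemma powr_bounds:
  "(1 - 4 * \<delta>) powr - s \<le> 2"
  "((1 - 2 ^ CARD('n) * \<delta>) * (1 - 4 * \<delta>)) powr - s \<le> 2"
  "((1 - 2 ^ CARD('n) * \<delta>) / (1 + 2 ^ CARD('n) * \<delta>)) powr - s \<le> 3"
proof -
  let ?D = "2 ^ CARD('n) :: real"
  have 1: "(1 - 4 * \<delta>) powr - s \<le> exp (8 * \<delta> * s)"
    using one_minus_powr_le[of "4 * \<delta>" s] \<delta> \<delta>_bounds s_pos by simp
  have 2: "(1 - ?D * \<delta>) powr - s \<le> exp (2 * ?D * \<delta> * s)"
    using one_minus_powr_le[of "?D * \<delta>" s] \<delta> \<delta>_bounds s_pos by (simp add: mult.assoc)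
  have e: "8 * \<delta> * s + 2 * ?D * \<delta> * s = 1 / 2" using s by (simp add: algebra_simps)
  have nn: "0 \<le> \<delta> * s" "0 \<le> ?D * \<delta> * s" using \<delta> s_pos by auto
  have "exp (8 * \<delta> * s) \<le> exp (1 / 2)" using e nn by simp
  with 1 exp_half_le show "(1 - 4 * \<delta>) powr - s \<le> 2" by linarith
  have "((1 - ?D * \<delta>) * (1 - 4 * \<delta>)) powr - s = (1 - ?D * \<delta>) powr - s * (1 - 4 * \<delta>) powr - s"
    using \<delta>_bounds by (intro powr_mult)
  also have "\<dots> \<le> exp (2 * ?D * \<delta> * s) * exp (8 * \<delta> * s)"
    using 1 2 by (intro mult_mono) auto
  also have "\<dots> = exp (1 / 2)" using e by (simp add: exp_add[symmetric] add.commute)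
  finally show "((1 - ?D * \<delta>) * (1 - 4 * \<delta>)) powr - s \<le> 2" using exp_half_le by linarith
  have "((1 - ?D * \<delta>) / (1 + ?D * \<delta>)) powr - s = (1 - ?D * \<delta>) powr - s * (1 + ?D * \<delta>) powr s"
    using \<delta>_bounds \<delta> by (subst powr_divide) (auto simp: powr_minus field_simps)
  also have "(1 + ?D * \<delta>) powr s \<le> exp (?D * \<delta>) powr s"
    using \<delta> s_pos by (intro powr_mono2) auto
  also have "\<dots> = exp (?D * \<delta> * s)" by (simp add: powr_def mult.commute)
  finally have "((1 - ?D * \<delta>) / (1 + ?D * \<delta>)) powr - s
      \<le> (1 - ?D * \<delta>) powr - s * exp (?D * \<delta> * s)"
    by (simp add: mult_left_mono)
  also have "\<dots> \<le> exp (2 * ?D * \<delta> * s) * exp (?D * \<delta> * s)"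
    using 2 by simp
  also have "\<dots> \<le> exp 1"
  proof -
    have "2 * ?D * \<delta> * s + ?D * \<delta> * s \<le> 1" using e nn by linarith
    then show ?thesis by (simp only: exp_add[symmetric] exp_le_cancel_iff)
  qed
  finally show "((1 - ?D * \<delta>) / (1 + ?D * \<delta>)) powr - s \<le> 3" using exp_le by linarith
qed

text \<open>Strong induction on the depth, in which the constant 4 reproduces itself as 2 + 2. The
  cells never stopped contribute 2. So do the stopped ones: they fill at most a quarter of the cell,
  which cancels the factor 4 of the induction hypothesis.\<close>

lemma dyadic_mean_le:
  "0 < l \<Longrightarrow> dyadic_mean k (\<lambda>a l. mean w a l powr - s) a l \<le> 4 * mean w a l powr - s"
proof (induction k arbitrary: a l rule: less_induct)
  case (less k)
  let ?D = "2 ^ CARD('n) :: real"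
  define c where "c = mean w a l"
  have c: "0 < c" using mean_pos less.prems by (simp add: c_def)
  \<comment> \<open>The gap \<open>c - ?t\<close> is four times the flatness bound
    \<open>\<delta> * c\<close> on the mean deficit; this is the source of the quarter.\<close>
  let ?t = "(1 - 4 * \<delta>) * c"
  let ?B = "4 * ((1 - ?D * \<delta>) * ?t) powr - s / (c - ?t)"
  have pos: "0 < 1 - ?D * \<delta>" "0 < 1 - 4 * \<delta>" using \<delta>_bounds by auto
  have gap: "c - ?t = 4 * \<delta> * c" by (simp add: algebra_simps)
  then have "?t < c" using \<delta> c by (smt (verit) mult_pos_pos)
  have "dyadic_mean k (\<lambda>a l. mean w a l powr - s) a l
      \<le> ?t powr - s + ?B * mean (\<lambda>x. max 0 (c - w x)) a l"
  proof (rule dyadic_mean_stopping)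
    show "?t \<le> mean w a l" using \<open>?t < c\<close> by (simp add: c_def)
  qed (use less \<open>?t < c\<close> s_pos pos c in auto)
  also have "\<dots> \<le> ?t powr - s + ?B * (\<delta> * c)"
    using flat[OF less.prems, of a] \<open>?t < c\<close> unfolding c_def[symmetric]
    by (intro add_left_mono mult_left_mono) auto
  also have "?B * (\<delta> * c) = ((1 - ?D * \<delta>) * ?t) powr - s"
    unfolding gap using \<delta> c by simp
  also have "(1 - ?D * \<delta>) * ?t = ((1 - ?D * \<delta>) * (1 - 4 * \<delta>)) * c" by simp
  also have "?t powr - s + (((1 - ?D * \<delta>) * (1 - 4 * \<delta>)) * c) powr - s
      = (1 - 4 * \<delta>) powr - s * c powr - s + ((1 - ?D * \<delta>) * (1 - 4 * \<delta>)) powr - s * c powr - s"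
    using pos c by (simp add: powr_mult)
  also have "\<dots> \<le> 2 * c powr - s + 2 * c powr - s"
    by (intro add_mono mult_right_mono powr_bounds) auto
  finally show ?case by (simp add: c_def)
qed

end

section \<open>From dyadic averages to the negative power of the weight\<close>

context very_flat_weight
begin

text \<open>The cells of side \<open>h\<close> at \<open>x\<close> and at \<open>b\<close> both lie
  in the cell of side \<open>2 * h\<close> at \<open>b\<close>, and both means are comparable with
  the mean over it. This transfers differentiation along cubes with corner \<open>x\<close> to
  dyadic cells containing \<open>x\<close>.\<close>

lemma mean_powr_le:
  assumes "0 < h" "x \<in> cell b h"
  shows "mean w x h powr - s \<le> 3 * mean w b h powr - s"
proof -
  let ?D = "2 ^ CARD('n) :: real"
  let ?r = "(1 - ?D * \<delta>) / (1 + ?D * \<delta>)"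
  define M where "M = mean w b (2 * h)"
  have M: "0 < M" "0 < mean w b h" unfolding M_def using assms(1) by (auto intro: mean_pos)
  have pos: "0 < 1 - ?D * \<delta>" "0 < 1 + ?D * \<delta>" using \<delta> \<delta>_bounds by (auto intro: add_pos_pos)
  have "cell b h \<subseteq> cell b (2 * h)" using assms(1) by (simp add: cell_def) (smt (verit) Collect_mono)
  then have "mean w b h \<le> (1 + ?D * \<delta>) * M"
    unfolding M_def by (intro subcell_le assms)
  then have "?r * mean w b h \<le> ?r * ((1 + ?D * \<delta>) * M)"
    using pos by (intro mult_left_mono) auto
  also have "\<dots> = (1 - ?D * \<delta>) * M" using pos by simp
  also have "\<dots> \<le> mean w x h"
    unfolding M_def
  proof (intro subcell_ge assms subsetI)
    fix y assume "y \<in> cell x h"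
    then show "y \<in> cell b (2 * h)"
      using assms by (simp add: cell_def) (smt (verit))
  qed
  finally have "mean w x h powr - s \<le> (?r * mean w b h) powr - s"
    using s_pos pos M by (intro powr_mono2') auto
  also have "\<dots> = ?r powr - s * mean w b h powr - s"
    using pos M by (intro powr_mult)
  also have "\<dots> \<le> 3 * mean w b h powr - s"
    using powr_bounds(3) by (intro mult_right_mono) auto
  finally show ?thesis .
qed

text \<open>Almost everywhere \<open>w x powr - s\<close> is a limit of powers of means over cells
  with corner \<open>x\<close>, hence at most the lower limit of 3 times the dyadic step functions.
  Fatou's lemma and the factor 4 of \<open>dyadic_mean_le\<close> give 12 = 3 * 4.\<close>

lemma nn_integral_powr_le:
  assumes "0 < l"
  shows "(\<integral>\<^sup>+x\<in>cell a l. ennreal (w x powr - s) \<partial>lebesgue)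
    \<le> ennreal (l ^ CARD('n) * (12 * mean w a l powr - s))"
proof -
  let ?g = "\<lambda>a l. mean w a l powr - s"
  let ?u = "\<lambda>k x. 3 * dyadic_fun k ?g a l x"
  have *: "ennreal (w x powr - s) * indicator (cell a l) x \<le> liminf (\<lambda>k. ?u k x)"
    if pos: "0 < w x" and lim: "(mean w x \<longlongrightarrow> w x) (at_right 0)" for x
  proof (cases "x \<in> cell a l")
    case True
    \<comment> \<open>These are the sides of the dyadic subcells, so that
      \<open>mean_powr_le\<close> applies at every depth.\<close>
    have "filterlim (\<lambda>k. l / 2 ^ k) (at_right 0) sequentially"
      using assms by real_asymp
    with lim have "(\<lambda>k. mean w x (l / 2 ^ k)) \<longlonglongrightarrow> w x"
      by (rule filterlim_compose)
    then have "(\<lambda>k. ennreal (mean w x (l / 2 ^ k) powr - s)) \<longlonglongrightarrow> ennreal (w x powr - s)"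
      using pos by (intro tendsto_ennrealI tendsto_powr tendsto_const) auto
    then have "ennreal (w x powr - s) = liminf (\<lambda>k. ennreal (mean w x (l / 2 ^ k) powr - s))"
      by (rule lim_imp_Liminf[OF trivial_limit_sequentially, symmetric])
    also have "\<dots> \<le> liminf (\<lambda>k. ?u k x)"
    proof (intro Liminf_mono always_eventually allI)
      fix k
      obtain b where b: "x \<in> cell b (l / 2 ^ k)"
        "dyadic_fun k ?g a l x = ennreal (?g b (l / 2 ^ k))"
        using dyadic_fun_eq[OF assms True] by blast
      then have "mean w x (l / 2 ^ k) powr - s \<le> 3 * ?g b (l / 2 ^ k)"
        using assms by (intro mean_powr_le) auto
      then have "ennreal (mean w x (l / 2 ^ k) powr - s) \<le> ennreal (3 * ?g b (l / 2 ^ k))"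
        by (rule ennreal_leI)
      also have "\<dots> = ?u k x" by (simp add: b(2) ennreal_mult)
      finally show "ennreal (mean w x (l / 2 ^ k) powr - s) \<le> ?u k x" .
    qed
    finally show ?thesis using True by simp
  qed simp
  have "AE x in lebesgue. ennreal (w x powr - s) * indicator (cell a l) x \<le> liminf (\<lambda>k. ?u k x)"
    using AE_pos AE_mean_tendsto by eventually_elim (rule *)
  then have "(\<integral>\<^sup>+x\<in>cell a l. ennreal (w x powr - s) \<partial>lebesgue)
      \<le> (\<integral>\<^sup>+x. liminf (\<lambda>k. ?u k x) \<partial>lebesgue)"
    by (rule nn_integral_mono_AE)
  also have "\<dots> \<le> liminf (\<lambda>k. \<integral>\<^sup>+x. ?u k x \<partial>lebesgue)"
    by (intro nn_integral_liminf) measurable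
  also have "\<dots> \<le> liminf (\<lambda>k::nat. ennreal (l ^ CARD('n) * (12 * mean w a l powr - s)))"
  proof (intro Liminf_mono always_eventually allI)
    fix k
    have "(\<integral>\<^sup>+x. ?u k x \<partial>lebesgue) = 3 * ennreal (l ^ CARD('n) * dyadic_mean k ?g a l)"
      using assms by (simp add: nn_integral_cmult nn_integral_dyadic_fun)
    also have "\<dots> = ennreal (3 * (l ^ CARD('n) * dyadic_mean k ?g a l))"
      using assms by (simp add: ennreal_mult dyadic_mean_nonneg)
    also have "\<dots> \<le> ennreal (l ^ CARD('n) * (12 * mean w a l powr - s))"
      using assms dyadic_mean_le[OF assms, of k a] by (intro ennreal_leI) simp
    finally show "(\<integral>\<^sup>+x. ?u k x \<partial>lebesgue) \<le> ennreal (l ^ CARD('n) * (12 * mean w a l powr - s))" .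
  qed
  also have "\<dots> = ennreal (l ^ CARD('n) * (12 * mean w a l powr - s))"
    by (simp add: Liminf_const)
  finally show ?thesis .
qed

end

subsection \<open>The Fujii--Wilson condition\<close>

lemma nn_integral_cbox_cell:
  "(\<integral>\<^sup>+x\<in>cbox a (a + (\<chi> i. l)). f x \<partial>lebesgue) = (\<integral>\<^sup>+x\<in>cell a l. f x \<partial>lebesgue)"
  by (rule nn_integral_cong_AE) (use AE_cell_cbox[of a l] in eventually_elim, auto simp: indicator_def)

lemma avg_cbox:
  fixes a :: "real ^ 'n"
  assumes "0 < l"
  shows "avg (cbox a (a + (\<chi> i. l))) f
    = (\<integral>\<^sup>+x\<in>cell a l. f x \<partial>lebesgue) / ennreal (l ^ CARD('n))"
  by (simp only: avg_def nn_integral_cbox_cell emeasure_cbox_side[OF assms])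

lemma nn_integral_cell:
  fixes f :: "real ^ 'n \<Rightarrow> real"
  assumes "0 < l" and f: "set_integrable lebesgue (cell a l) f" and nonneg: "AE x in lebesgue. 0 \<le> f x"
  shows "(\<integral>\<^sup>+x\<in>cell a l. ennreal (f x) \<partial>lebesgue) = ennreal (l ^ CARD('n) * mean f a l)"
proof -
  have "(\<integral>\<^sup>+x\<in>cell a l. ennreal (f x) \<partial>lebesgue)
      = (\<integral>\<^sup>+x. ennreal (indicat_real (cell a l) x *\<^sub>R f x) \<partial>lebesgue)"
    by (intro nn_integral_cong) (auto simp: indicator_def)
  also have "\<dots> = ennreal (LINT x:cell a l|lebesgue. f x)"
    unfolding set_lebesgue_integral_def using f nonneg
    by (intro nn_integral_eq_integral) (auto simp: set_integrable_def indicator_def)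
  finally show ?thesis using assms(1) by (simp add: mean_def)
qed

context weight_function
begin

lemma avg_weight:
  assumes "0 < l"
  shows "avg (cbox a (a + (\<chi> i. l))) (\<lambda>x. ennreal (w x)) = ennreal (mean w a l)"
proof -
  have "AE x in lebesgue. 0 \<le> w x" using AE_pos by eventually_elim simp
  then show ?thesis
    using assms mean_pos[OF assms, of a]
    by (simp add: avg_cbox nn_integral_cell integrable_cell divide_ennreal)
qed

lemma maximal_ge_mean:
  assumes "0 < h" "x \<in> cbox b (b + (\<chi> i. h))" and sub: "cbox b (b + (\<chi> i. h)) \<subseteq> Q"
  shows "ennreal (mean w b h) \<le> maximal (\<lambda>y. w y * indicator Q y) x"
proof -
  let ?R = "cbox b (b + (\<chi> i. h))"
  \<comment> \<open>Inside \<open>Q\<close> the truncation is invisible, and the absolute value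
    changes \<open>w\<close> only on a null set.\<close>
  have "avg ?R (\<lambda>y. ennreal \<bar>w y * indicator Q y\<bar>) = avg ?R (\<lambda>y. ennreal (w y))"
    unfolding avg_def
    by (intro arg_cong2[where f = "(/)"] nn_integral_cong_AE refl, use AE_pos in eventually_elim)
      (use sub in \<open>auto simp: indicator_def\<close>)
  then have "ennreal (mean w b h) = avg ?R (\<lambda>y. ennreal \<bar>w y * indicator Q y\<bar>)"
    using avg_weight[OF assms(1)] by simp
  also have "\<dots> \<le> maximal (\<lambda>y. w y * indicator Q y) x"
    unfolding maximal_def using assms by (intro SUP_upper) (auto simp: cubes_def)
  finally show ?thesis .
qed

text \<open>Interior points suffice, the faces being null. The bound by \<open>w\<close> comes from
  small cubes with lower corner \<open>x\<close>, the bound by the mean from the whole cube.\<close>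

lemma AE_maximal_ge:
  assumes "0 < l"
  shows "AE x in lebesgue. x \<in> cbox a (a + (\<chi> i. l)) \<longrightarrow>
    ennreal (max (w x) (mean w a l)) \<le> maximal (\<lambda>y. w y * indicator (cbox a (a + (\<chi> i. l))) y) x"
  using AE_mean_tendsto AE_cbox_box[of a "a + (\<chi> i. l)"]
proof eventually_elim
  case (elim x)
  let ?Q = "cbox a (a + (\<chi> i. l))"
  let ?M = "maximal (\<lambda>y. w y * indicator ?Q y) x"
  show ?case
  proof
    assume x: "x \<in> ?Q"
    then have box: "a $ i < x $ i" "x $ i < a $ i + l" for i
      using elim by (auto simp: mem_box_cart)
    \<comment> \<open>For an interior point, all small cubes with lower corner \<open>x\<close> stay
      inside \<open>?Q\<close>.\<close>
    have "eventually (\<lambda>h. h < a $ i + l - x $ i) (at_right 0)" for i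
      using box(2)[of i] by (intro eventually_at_rightI[of 0 "a $ i + l - x $ i"]) auto
    then have "eventually (\<lambda>h. \<forall>i. h < a $ i + l - x $ i) (at_right 0)"
      by (rule eventually_all_finite)
    then have "eventually (\<lambda>h. ennreal (mean w x h) \<le> ?M) (at_right 0)"
      using eventually_at_right_less
    proof eventually_elim
      case (elim h)
      show ?case
      proof (rule maximal_ge_mean)
        have "y $ i \<le> a $ i + l" if "y $ i \<le> x $ i + h" for y :: "real ^ 'n" and i
          using that elim(1)[rule_format, of i] by linarith
        moreover have "a $ i \<le> y $ i" if "x $ i \<le> y $ i" for y :: "real ^ 'n" and i
          using that box(1)[of i] by linarith
        ultimately show "cbox x (x + (\<chi> i. h)) \<subseteq> ?Q"
          by (auto simp: mem_box_cart)
      qed (use elim in \<open>auto simp: mem_box_cart\<close>)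
    qed
    moreover have "((\<lambda>h. ennreal (mean w x h)) \<longlongrightarrow> ennreal (w x)) (at_right 0)"
      using elim(1) by (rule tendsto_ennrealI)
    ultimately have "ennreal (w x) \<le> ?M"
      by (intro tendsto_upperbound) auto
    moreover have "ennreal (mean w a l) \<le> ?M"
      using assms x by (intro maximal_ge_mean) auto
    ultimately show "ennreal (max (w x) (mean w a l)) \<le> ?M"
      by (simp add: max_def)
  qed
qed

text \<open>With \<open>m\<close> the mean, the average of \<open>max (w x) m\<close> over the cube
  is at most that of the maximal function, hence at most \<open>K * m\<close>; subtracting
  \<open>m\<close> leaves the excess.\<close>

lemma mean_above_le:
  assumes "Ainfty_const w \<le> ennreal K" "0 \<le> K" "0 < l"
  shows "mean (\<lambda>x. max 0 (w x - mean w a l)) a l \<le> (K - 1) * mean w a l"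
proof -
  let ?Q = "cbox a (a + (\<chi> i. l))" and ?V = "l ^ CARD('n)"
  define m where "m = mean w a l"
  have m: "0 < m" using assms by (simp add: m_def mean_pos)
  let ?N = "\<integral>\<^sup>+x\<in>?Q. maximal (\<lambda>y. w y * indicator ?Q y) x \<partial>lebesgue"
  have nonneg: "AE x in lebesgue. 0 \<le> w x" using AE_pos by eventually_elim simp
  have W: "(\<integral>\<^sup>+x\<in>?Q. ennreal (w x) \<partial>lebesgue) = ennreal (?V * m)"
    using nonneg by (simp add: nn_integral_cbox_cell nn_integral_cell integrable_cell assms m_def)
  have Vm: "0 < ?V * m" using assms m by simp
  have "?N / ennreal (?V * m) \<le> Ainfty_const w"
    unfolding Ainfty_const_def W[symmetric] using assms(3)
    by (intro SUP_upper) (auto simp: cubes_def)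
  also note assms(1)
  finally have "?N / ennreal (?V * m) * ennreal (?V * m) \<le> ennreal K * ennreal (?V * m)"
    by (rule mult_right_mono) simp
  also have "ennreal (?V * m) / ennreal (?V * m) = 1"
    using assms m by (simp add: divide_ennreal)
  then have "?N / ennreal (?V * m) * ennreal (?V * m) = ?N"
    by (simp add: ennreal_divide_times)
  finally have N: "?N \<le> ennreal (K * (?V * m))"
    using assms Vm by (simp add: ennreal_mult)
  \<comment> \<open>\<open>max (w x) m\<close> is written as the excess minus the constant
    \<open>- m\<close>, a form to which \<open>mean_diff\<close> applies.\<close>
  have int: "set_integrable lebesgue (cell a l) (\<lambda>x. max 0 (w x - m) - (- m))"
    using assms by (intro set_integral_diff integrable_above set_integrable_cell_const) auto
  have "ennreal (?V * mean (\<lambda>x. max 0 (w x - m) - (- m)) a l)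
      = (\<integral>\<^sup>+x\<in>cell a l. ennreal (max 0 (w x - m) - (- m)) \<partial>lebesgue)"
    using assms(3) int m by (intro nn_integral_cell[symmetric]) auto
  also have "\<dots> = (\<integral>\<^sup>+x\<in>?Q. ennreal (max 0 (w x - m) - (- m)) \<partial>lebesgue)"
    by (simp only: nn_integral_cbox_cell)
  also have "\<dots> \<le> ?N"
  proof (rule nn_integral_mono_AE)
    have *: "max 0 (w x - m) - (- m) = max (w x) m" for x by auto
    show "AE x in lebesgue. ennreal (max 0 (w x - m) - (- m)) * indicator ?Q x
        \<le> maximal (\<lambda>y. w y * indicator ?Q y) x * indicator ?Q x"
      using AE_maximal_ge[OF assms(3), of a] unfolding *
      unfolding m_def
      by eventually_elim (auto simp: indicator_def)
  qed
  also note N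
  finally have "?V * mean (\<lambda>x. max 0 (w x - m) - (- m)) a l \<le> K * (?V * m)"
    using assms Vm by (simp add: ennreal_le_iff)
  also have "mean (\<lambda>x. max 0 (w x - m) - (- m)) a l = mean (\<lambda>x. max 0 (w x - m)) a l + m"
    using assms by (subst mean_diff) (auto simp: mean_const intro: integrable_above set_integrable_cell_const)
  finally have "?V * (mean (\<lambda>x. max 0 (w x - m)) a l + m) \<le> ?V * (K * m)"
    by (simp add: ac_simps)
  then have "mean (\<lambda>x. max 0 (w x - m)) a l + m \<le> K * m"
    using assms by (simp only: mult_le_cancel_left_pos zero_less_power)
  then show ?thesis by (simp add: m_def algebra_simps)
qed

text \<open>The Fujii--Wilson condition controls the excess over the mean, and the deficit has the
  same mean by \<open>mean_above_eq\<close>.\<close>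

lemma flat_weightI:
  assumes "Ainfty_const w \<le> ennreal K" "0 \<le> K"
  shows "flat_weight w (K - 1)"
  using mean_above_le[OF assms] mean_above_eq
  by unfold_locales auto

lemma one_le_Ainfty_const:
  assumes "Ainfty_const w \<le> ennreal K" "0 \<le> K"
  shows "1 \<le> K"
proof -
  have "0 \<le> (K - 1) * mean w 0 1"
    using mean_above_le[OF assms, of 1 0] mean_nonneg[of 1 "\<lambda>x. max 0 (w x - mean w 0 1)" 0] by simp
  then show ?thesis using mean_pos[of 1 0] by (simp add: zero_le_mult_iff)
qed

end

subsection \<open>The Muckenhoupt constants\<close>

lemma ennpowr_le:
  assumes "t \<le> ennreal x" "0 \<le> x" "0 < r"
  shows "ennpowr t r \<le> ennreal (x powr r)"
proof -
  have t: "t \<noteq> \<infinity>" using assms(1) by (auto simp: top_unique)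
  then have "enn2real t \<le> x" using assms by (metis enn2real_ennreal enn2real_mono ennreal_less_top)
  then show ?thesis
    using t assms by (auto simp: ennpowr_def intro!: ennreal_leI powr_mono2)
qed

text \<open>With p - 1 = 1/s the dual power 1 - p' is -s. Raising \<open>12 * m powr - s\<close> to
  the power 1/s gives 12^(1/s) / m, and the average \<open>m\<close> of \<open>w\<close> cancels the
  denominator.\<close>

lemma (in very_flat_weight) Ap_const_le:
  fixes p :: real
  assumes "p = 1 + 1 / s"
  shows "Ap_const p w \<le> ennreal (12 powr (p - 1))"
proof -
  have p: "p \<noteq> 1" "1 - conj_exponent p = - s" "p - 1 = 1 / s"
    using s_pos by (auto simp: assms conj_exponent_def field_simps)
  have "avg Q (\<lambda>x. ennreal (w x)) * ennpowr (avg Q (\<lambda>x. ennreal (w x powr - s))) (1 / s)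
      \<le> ennreal (12 powr (1 / s))" if Q: "Q \<in> cubes" for Q
  proof -
    obtain a l where l: "0 < l" and Q: "Q = cbox a (a + (\<chi> i. l))"
      using Q by (auto simp: cubes_def)
    define m where "m = mean w a l"
    have m: "0 < m" using l by (simp add: m_def mean_pos)
    have "avg Q (\<lambda>x. ennreal (w x powr - s)) \<le> ennreal (l ^ CARD('n) * (12 * m powr - s)) / ennreal (l ^ CARD('n))"
      unfolding Q avg_cbox[OF l] m_def by (intro divide_right_mono_ennreal nn_integral_powr_le l)
    also have "\<dots> = ennreal (12 * m powr - s)"
      using l by (simp add: divide_ennreal)
    finally have "ennpowr (avg Q (\<lambda>x. ennreal (w x powr - s))) (1 / s)
        \<le> ennreal ((12 * m powr - s) powr (1 / s))"
      using s_pos by (intro ennpowr_le) auto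
    also have "(12 * m powr - s) powr (1 / s) = 12 powr (1 / s) * (m powr - s) powr (1 / s)"
      by (simp add: powr_mult)
    also have "(m powr - s) powr (1 / s) = inverse m"
      using s_pos m by (simp only: powr_powr) (simp add: powr_neg_one divide_inverse)
    finally have "avg Q (\<lambda>x. ennreal (w x)) * ennpowr (avg Q (\<lambda>x. ennreal (w x powr - s))) (1 / s)
        \<le> ennreal m * ennreal (12 powr (1 / s) * inverse m)"
      unfolding Q avg_weight[OF l] m_def by (intro mult_left_mono) auto
    also have "\<dots> = ennreal (12 powr (1 / s))"
      using m by (simp add: ennreal_mult[symmetric])
    finally show ?thesis .
  qed
  then show ?thesis
    unfolding Ap_const_def p using p(1) by (auto intro!: SUP_least)
qed

text \<open>Without any deficit, \<open>w\<close> is at least its mean almost everywhere on each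
  cube. This covers p = 1, which has its own branch in \<open>Ap_const\<close>.\<close>

lemma (in flat_weight) A1_const_le:
  assumes "\<delta> = 0"
  shows "Ap_const 1 w \<le> 1"
proof -
  have "avg Q (\<lambda>x. ennreal (w x)) * esssup (restrict_space lebesgue Q) (\<lambda>x. inverse (ennreal (w x))) \<le> 1"
    if Q: "Q \<in> cubes" for Q
  proof -
    obtain a l where l: "0 < l" and Q: "Q = cbox a (a + (\<chi> i. l))"
      using Q by (auto simp: cubes_def)
    define m where "m = mean w a l"
    have m: "0 < m" using l by (simp add: m_def mean_pos)
    have "mean (\<lambda>x. max 0 (m - w x)) a l = 0"
      using flat[OF l, of a] mean_nonneg[OF l, of "\<lambda>x. max 0 (m - w x)" a] assms by (simp add: m_def)
    then have "(\<integral>\<^sup>+x\<in>cell a l. ennreal (max 0 (m - w x)) \<partial>lebesgue) = 0"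
      using l by (subst nn_integral_cell) (auto intro: integrable_below)
    then have "AE x in lebesgue. ennreal (max 0 (m - w x)) * indicator (cell a l) x = 0"
      by (subst (asm) nn_integral_0_iff_AE) auto
    then have "AE x in lebesgue. x \<in> Q \<longrightarrow> inverse (ennreal (w x)) \<le> ennreal (inverse m)"
      using AE_cell_cbox[of a l]
    proof eventually_elim
      case (elim x)
      show ?case
      proof
        assume "x \<in> Q"
        with elim have "m \<le> w x" by (auto simp: Q indicator_def max_def split: if_splits)
        then show "inverse (ennreal (w x)) \<le> ennreal (inverse m)"
          using m by (simp add: inverse_ennreal)
      qed
    qed
    then have "AE x in restrict_space lebesgue Q. inverse (ennreal (w x)) \<le> ennreal (inverse m)"
      by (subst AE_restrict_space_iff) (auto simp: Q)
    then have "esssup (restrict_space lebesgue Q) (\<lambda>x. inverse (ennreal (w x))) \<le> ennreal (inverse m)"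
      by (intro esssup_I measurable_restrict_space1) measurable
    then have "avg Q (\<lambda>x. ennreal (w x)) * esssup (restrict_space lebesgue Q) (\<lambda>x. inverse (ennreal (w x)))
        \<le> ennreal m * ennreal (inverse m)"
      unfolding Q avg_weight[OF l] m_def by (intro mult_left_mono) auto
    also have "\<dots> = 1" using m by (simp add: ennreal_mult[symmetric])
    finally show ?thesis .
  qed
  then show ?thesis
    unfolding Ap_const_def by (auto intro!: SUP_least)
qed

theorem theorem1p1:
  shows "\<exists>c \<tau> \<tau>' :: real. 0 < c \<and> 0 < \<tau> \<and> 0 < \<tau>' \<and>
    (\<forall>w :: real ^ 'n \<Rightarrow> real.
       w \<in> Ainfty \<longrightarrow> Ainfty_const w \<le> ennreal (1 + c) \<longrightarrow>
       (let \<delta> = enn2real (Ainfty_const w) - 1; p = 1 + \<tau> * \<delta> in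
          w \<in> Ap p \<and> Ap_const p w \<le> ennreal (exp (\<tau>' * \<delta>))))"
proof -
  let ?D = "2 ^ CARD('n) :: real"
  \<comment> \<open>\<open>c\<close> is the largest \<delta> that \<open>very_flat_weight\<close>
    admits, and \<tau> is the factor for which its exponent is s = 1 / (\<tau> \<delta>).\<close>
  define c where "c = 1 / (8 + 2 * ?D)"
  define \<tau> where "\<tau> = 16 + 4 * ?D"
  have pos: "0 < 8 + 2 * ?D" "0 < c" "0 < \<tau>" by (auto simp: c_def \<tau>_def add_pos_pos)
  \<comment> \<open>The witness for \<tau>' is \<tau> ln 12, since 12^(p - 1) = exp (\<tau> \<delta>
    ln 12).\<close>
  have "w \<in> Ap (1 + \<tau> * \<delta>) \<and> Ap_const (1 + \<tau> * \<delta>) w \<le> ennreal (exp (\<tau> * ln 12 * \<delta>))"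
    if w: "w \<in> Ainfty" and le: "Ainfty_const w \<le> ennreal (1 + c)"
      and \<delta>: "\<delta> = enn2real (Ainfty_const w) - 1" for w :: "real ^ 'n \<Rightarrow> real" and \<delta>
  proof -
    have weight: "weight w" using w by (auto simp: Ainfty_def Ap_def)
    interpret weight_function w by unfold_locales (rule weight)
    \<comment> \<open>The constant is finite, so \<open>enn2real\<close> loses nothing.\<close>
    have K: "Ainfty_const w \<le> ennreal (1 + \<delta>)" "0 \<le> 1 + \<delta>"
      using le_less_trans[OF le ennreal_less_top] by (auto simp: \<delta>)
    have "0 \<le> \<delta>" using one_le_Ainfty_const[OF K] by simp
    have "\<delta> \<le> c" using le pos unfolding \<delta>
      by (metis (no_types, opaque_lifting) K(2) \<delta> add.commute add_pos_pos diff_le_eq enn2real_leI less_eq_real_def zero_less_one)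
    interpret flat_weight w \<delta> using flat_weightI[OF K] by simp
    have bound: "Ap_const (1 + \<tau> * \<delta>) w \<le> ennreal (exp (\<tau> * ln 12 * \<delta>))"
    \<comment> \<open>For \<delta> = 0 the exponent s would be 1/0; there p = 1 and the claimed
      bound is exp 0 = 1.\<close>
    proof (cases "\<delta> = 0")
      case True
      then show ?thesis using A1_const_le by simp
    next
      case False
      define s where "s = 1 / (\<tau> * \<delta>)"
      interpret very_flat_weight w \<delta> s
      proof
        show "\<delta> * (8 + 2 * 2 ^ CARD('n)) \<le> 1"
          using \<open>\<delta> \<le> c\<close> pos by (simp add: c_def field_simps)
      qed (use False \<open>0 \<le> \<delta>\<close> pos in \<open>auto simp: s_def \<tau>_def mult.commute\<close>)
      show ?thesis
        using Ap_const_le[of "1 + \<tau> * \<delta>"] by (simp add: s_def powr_def ac_simps)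
    qed
    moreover have "Ap_const (1 + \<tau> * \<delta>) w < \<infinity>"
      using bound by (rule le_less_trans) simp
    ultimately show ?thesis
      using weight \<open>0 \<le> \<delta>\<close> pos by (simp add: Ap_def)
  qed
  then show ?thesis
    using pos by (intro exI[of _ c] exI[of _ \<tau>] exI[of _ "\<tau> * ln 12"]) (simp add: Let_def)
qed

end
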